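(* There exist an unbounded proper metric space $(X,d)$ (with a basepoint $x_0\in X$) and a $\sigma$-compact subset $D\subset \nu_P X$ of its subpower Higson corona $\nu_P X$ such that $D$ is not $C^*$-embedded in $\nu_P X$; that is, there is a bounded continuous function $f\colon D\to\mathbb{R}$ that does not admit a continuous extension to $\nu_P X$.
   Context: A metric space is proper if each of its closed bounded subsets is compact. Let $(X,d)$ be an unbounded proper metric space with basepoint $x_0$; write $|x|=d(x,x_0)$ and let $B_r(x)$ denote the ball of radius $r$ centred at $x$. A function $p\colon\mathbb{R}_+\to\mathbb{R}_+$ is asymptotically subpower if for every $\alpha>0$ there exists $t_0>0$ such that $p(t)<t^\alpha$ for all $t>t_0$. A bounded continuous function $f\colon X\to\mathbb{R}$ is Higson subpower if for every asymptotically subpower function $p$ and every $\epsilon>0$ there exists $r_0>0$ such that $\mathrm{diam}(f(B_{p(|x|)}(x)))<\epsilon$ for all $x\in X$ with $|x|>r_0$. The Higson subpower functions form a closed subalgebra of the algebra of bounded continuous real functions on $X$; it contains the constants and separates points from closed sets. The Higson subpower compactification $h_PX$ is the (Hausdorff) compactification of $X$ corresponding to this subalgebra, i.e. the one for which a bounded continuous function $X\to\mathbb{R}$ extends continuously to $h_PX$ if and only if it is Higson subpower. The subpower Higson corona of $X$ is the remainder $\nu_PX=h_PX\setminus X$ with the subspace topology. A subset $D$ of a topological space $Z$ is $C^*$-embedded in $Z$ if every bounded continuous real-valued function on $D$ extends to a continuous function on $Z$. *)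

theory Defs
  imports "HOL-Analysis.Analysis"
begin

definition proper_metric :: "'a metric \<Rightarrow> bool" where
  "proper_metric X \<longleftrightarrow>
     (\<forall>S. closedin (mtopology_of X) S \<and> Metric_space.mbounded (mspace X) (mdist X) S
        \<longrightarrow> compactin (mtopology_of X) S)"

definition unbounded_metric :: "'a metric \<Rightarrow> bool" where
  "unbounded_metric X \<longleftrightarrow> \<not> Metric_space.mbounded (mspace X) (mdist X) (mspace X)"

definition asymptotically_subpower :: "(real \<Rightarrow> real) \<Rightarrow> bool" where
  "asymptotically_subpower p \<longleftrightarrow>
     (\<forall>t\<ge>0. p t \<ge> 0) \<and> (\<forall>\<alpha>>0. \<exists>t0>0. \<forall>t>t0. p t < t powr \<alpha>)"

definition bounded_continuous :: "'a topology \<Rightarrow> ('a \<Rightarrow> real) \<Rightarrow> bool" where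
  "bounded_continuous T f \<longleftrightarrow> continuous_map T euclideanreal f \<and> bounded (f ` topspace T)"

(* mball_of is the open ball; closed balls give the same functions, since p + 1 is asymptotically
   subpower whenever p is. An empty ball (p = 0) contributes diameter {} = 0. *)
definition higson_subpower :: "'a metric \<Rightarrow> 'a \<Rightarrow> ('a \<Rightarrow> real) \<Rightarrow> bool" where
  "higson_subpower X x0 f \<longleftrightarrow>
     bounded_continuous (mtopology_of X) f \<and>
     (\<forall>p. asymptotically_subpower p \<longrightarrow>
        (\<forall>\<epsilon>>0. \<exists>r0>0. \<forall>x\<in>mspace X. mdist X x x0 > r0 \<longrightarrow>
           diameter (f ` mball_of X x (p (mdist X x x0))) < \<epsilon>))"

definition hausdorff_compactification :: "'a topology \<Rightarrow> 'b topology \<Rightarrow> ('a \<Rightarrow> 'b) \<Rightarrow> bool" where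
  "hausdorff_compactification T K e \<longleftrightarrow>
     compact_space K \<and> Hausdorff_space K \<and> embedding_map T K e \<and>
     K closure_of (e ` topspace T) = topspace K"

(* (K, e) is the compactification of X whose algebra of extendable functions consists of the
   Higson subpower functions. The equivalence determines (K, e) up to a homeomorphism commuting
   with the embeddings. *)
definition higson_subpower_compactification ::
    "'a metric \<Rightarrow> 'a \<Rightarrow> 'b topology \<Rightarrow> ('a \<Rightarrow> 'b) \<Rightarrow> bool" where
  "higson_subpower_compactification X x0 K e \<longleftrightarrow>
     hausdorff_compactification (mtopology_of X) K e \<and>
     (\<forall>f. bounded_continuous (mtopology_of X) f \<longrightarrow>
        ((\<exists>g. continuous_map K euclideanreal g \<and> (\<forall>x\<in>mspace X. g (e x) = f x))
           \<longleftrightarrow> higson_subpower X x0 f))"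

definition corona :: "'a metric \<Rightarrow> 'b topology \<Rightarrow> ('a \<Rightarrow> 'b) \<Rightarrow> 'b topology" where
  "corona X K e = subtopology K (topspace K - e ` mspace X)"

definition sigma_compactin :: "'a topology \<Rightarrow> 'a set \<Rightarrow> bool" where
  "sigma_compactin Z D \<longleftrightarrow> (\<exists>C :: nat \<Rightarrow> 'a set. (\<forall>n. compactin Z (C n)) \<and> D = (\<Union>n. C n))"

definition C_star_embedded :: "'a topology \<Rightarrow> 'a set \<Rightarrow> bool" where
  "C_star_embedded Z D \<longleftrightarrow>
     D \<subseteq> topspace Z \<and>
     (\<forall>f. bounded_continuous (subtopology Z D) f \<longrightarrow>
        (\<exists>g. continuous_map Z euclideanreal g \<and> (\<forall>x\<in>D. g x = f x)))"

(* On the types used for the existence claim: a proper metric space is separable, so up to isometry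
   its points form a set of reals; and a Hausdorff space with a countable dense subset has at most
   as many points as there are sets of reals, so up to homeomorphism its compactification lives on
   the type (real => real) => real. *)

end

(* The space consists of 0 and of pairs a_j < b_j with a_j = 4^(j+1) and gap a_j^(1/(m+2)), where the
   index m of the pair takes every value infinitely often. For fixed m the gap outgrows every subpower
   function, so the indicator of the set A_m of left points of index m is Higson subpower, and so is that of the
   set B_m of right points. The traces of the A_m and B_m on the corona are therefore pairwise
   disjoint and clopen; D is their union, and f is 1 on the traces of the A_m and 0 on those of the
   B_m. An extension of f to the corona extends further to the compactification by Tietze, hence
   restricts to a Higson subpower function on the space. For all but finitely many pairs of index m
   this function is close to 1 on the left and to 0 on the right point, whereas the Higson condition
   forces it to vary little on gaps below some power a^alpha, in particular when 1/(m+2) < alpha. *)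
theory Submission
  imports Defs
begin

section \<open>Separation axioms for function types with the product topology\<close>

lemma open_vimage_apply:
  fixes W :: "'b::topological_space set"
  shows "open W \<Longrightarrow> open ((\<lambda>h :: 'a \<Rightarrow> 'b. h a) -` W)"
  by (rule open_vimage) simp_all

text \<open>The points of the compactification will be functions, and both Stone-Weierstrass and
  closedness of compact sets ask for a \<open>t2_space\<close> type. Its superclasses come first.
  Each axiom is inherited from a single coordinate in which the two functions differ.\<close>

instance "fun" :: (type, t0_space) t0_space
proof
  fix f g :: "'a \<Rightarrow> 'b"
  assume "f \<noteq> g"
  then obtain a where a: "f a \<noteq> g a" by blast
  obtain U where "open U" "\<not> (f a \<in> U \<longleftrightarrow> g a \<in> U)"
    using t0_space_class.t0_space[OF a] by blast
  then show "\<exists>U. open U \<and> \<not> (f \<in> U \<longleftrightarrow> g \<in> U)"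
    by (intro exI[of _ "(\<lambda>h. h a) -` U"]) (simp add: open_vimage_apply)
qed

instance "fun" :: (type, t1_space) t1_space
proof
  fix f g :: "'a \<Rightarrow> 'b"
  assume "f \<noteq> g"
  then obtain a where a: "f a \<noteq> g a" by blast
  obtain U where "open U" "f a \<in> U" "g a \<notin> U"
    using t1_space_class.t1_space[OF a] by blast
  then show "\<exists>U. open U \<and> f \<in> U \<and> g \<notin> U"
    by (intro exI[of _ "(\<lambda>h. h a) -` U"]) (simp add: open_vimage_apply)
qed

instance "fun" :: (type, t2_space) t2_space
proof
  fix f g :: "'a \<Rightarrow> 'b"
  assume "f \<noteq> g"
  then obtain a where a: "f a \<noteq> g a" by blast
  obtain U V where UV: "open U" "open V" "f a \<in> U" "g a \<in> V" "U \<inter> V = {}"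
    using hausdorff[OF a] by blast
  have "(\<lambda>h. h a) -` U \<inter> (\<lambda>h. h a) -` V = {}"
    using UV(5) by blast
  with UV show "\<exists>U V. open U \<and> open V \<and> f \<in> U \<and> g \<in> V \<and> U \<inter> V = {}"
    by (intro exI[of _ "(\<lambda>h. h a) -` U"] exI[of _ "(\<lambda>h. h a) -` V"])
      (simp add: open_vimage_apply)
qed

section \<open>The Higson condition expressed through powers\<close>

text \<open>The function \<open>p\<close> is supported on the values of \<open>s\<close>. A value
  may be attained at several indices, so \<open>p\<close> uses a chosen index m, and the conclusion
  promises only some m with the same value. Only finitely many m have 1/(m+1) \<ge> \<alpha>; beyond
  the corresponding values \<open>p\<close> lies below the power with exponent \<alpha>.\<close>

lemma asymptotically_subpower_witness:
  fixes s :: "nat \<Rightarrow> real"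
  assumes s: "\<And>n. s n > real n"
  obtains p where "asymptotically_subpower p"
    "\<And>n. \<exists>m. s m = s n \<and> p (s n) = s n powr (1 / real (Suc m))"
proof -
  define p where
    "p t = (if t \<in> range s then t powr (1 / real (Suc (SOME m. s m = t))) else 0)" for t
  have wit: "\<exists>m. s m = s n \<and> p (s n) = s n powr (1 / real (Suc m))" for n
    by (rule exI[of _ "SOME m. s m = s n"]) (auto simp: p_def intro: someI[of "\<lambda>m. s m = s n"])
  have "\<exists>t0>0. \<forall>t>t0. p t < t powr \<alpha>" if "\<alpha> > 0" for \<alpha> :: real
  proof -
    obtain N :: nat where N: "1 / \<alpha> < real N"
      using reals_Archimedean2 by blast
    \<comment> \<open>A value \<open>s m\<close> above \<open>t0\<close> has m \<ge> N. The entry 1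
      keeps the base above 1, so that powers increase strictly with the exponent.\<close>
    define t0 where "t0 = Max (insert 1 (s ` {..<N}))"
    have t0: "t0 \<ge> 1" "\<And>n. n < N \<Longrightarrow> s n \<le> t0"
      by (auto simp: t0_def)
    show ?thesis
    proof (intro exI conjI allI impI)
      show "t0 > 0" using t0(1) by simp
      fix t assume t: "t > t0"
      show "p t < t powr \<alpha>"
      proof (cases "t \<in> range s")
        case True
        then obtain n where "t = s n" by auto
        with wit[of n] obtain m where m: "s m = t" "p t = t powr (1 / real (Suc m))" by metis
        have "N \<le> m" using t t0(2)[of m] m(1) by force
        then have "1 / \<alpha> < real (Suc m)" using N by simp
        then have "1 / real (Suc m) < \<alpha>"
          using \<open>\<alpha> > 0\<close> by (simp add: field_simps)
        then show ?thesis using m(2) t t0(1) by simp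
      next
        case False
        then show ?thesis using t t0(1) by (simp add: p_def)
      qed
    qed
  qed
  moreover have "p t \<ge> 0" for t by (simp add: p_def)
  ultimately have "asymptotically_subpower p"
    by (auto simp: asymptotically_subpower_def)
  with wit show thesis using that by blast
qed

text \<open>This trades the quantifier over all subpower functions for one exponent per \<epsilon>.
  If no exponent works, counterexamples for the exponents 1/(n+1) are glued into one subpower
  \<open>p\<close> that violates the definition. Conversely, every subpower \<open>p\<close> is
  eventually below the power with the given exponent.\<close>

lemma higson_subpower_iff:
  "higson_subpower X x0 f \<longleftrightarrow>
     bounded_continuous (mtopology_of X) f \<and>
     (\<forall>\<epsilon>>0. \<exists>\<alpha>>0. \<exists>r. \<forall>x\<in>mspace X. \<forall>y\<in>mspace X.
        mdist X x x0 > r \<longrightarrow> mdist X x y < mdist X x x0 powr \<alpha> \<longrightarrow> \<bar>f x - f y\<bar> < \<epsilon>)"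
  (is "_ \<longleftrightarrow> _ \<and> ?R")
proof (cases "bounded_continuous (mtopology_of X) f")
  case bc: True
  have bdd: "bounded (f ` S)" if "S \<subseteq> mspace X" for S
    using bc that by (auto simp: bounded_continuous_def intro: bounded_subset)
  show ?thesis
  proof
    assume h: "higson_subpower X x0 f"
    have ?R
    proof (rule ccontr)
      assume "\<not> ?R"
      then obtain \<epsilon> where "\<epsilon> > 0" and bad: "\<And>\<alpha> r. \<alpha> > 0 \<Longrightarrow> \<exists>x\<in>mspace X. \<exists>y\<in>mspace X.
          mdist X x x0 > r \<and> mdist X x y < mdist X x x0 powr \<alpha> \<and> \<bar>f x - f y\<bar> \<ge> \<epsilon>"
        by (meson not_less)
      have "\<forall>n. \<exists>x y. x \<in> mspace X \<and> y \<in> mspace X \<and> mdist X x x0 > real n \<and>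
          mdist X x y < mdist X x x0 powr (1 / real (Suc n)) \<and> \<bar>f x - f y\<bar> \<ge> \<epsilon>"
        using bad[of "1 / real (Suc _)"] by (meson divide_pos_pos of_nat_0_less_iff zero_less_Suc zero_less_one)
      then obtain x y where xy: "\<And>n. x n \<in> mspace X" "\<And>n. y n \<in> mspace X"
        "\<And>n. mdist X (x n) x0 > real n"
        "\<And>n. mdist X (x n) (y n) < mdist X (x n) x0 powr (1 / real (Suc n))"
        "\<And>n. \<bar>f (x n) - f (y n)\<bar> \<ge> \<epsilon>"
        by metis
      obtain p where p: "asymptotically_subpower p" and
        "\<And>n. \<exists>m. mdist X (x m) x0 = mdist X (x n) x0 \<and>
          p (mdist X (x n) x0) = mdist X (x n) x0 powr (1 / real (Suc m))"
        using asymptotically_subpower_witness[of "\<lambda>n. mdist X (x n) x0", OF xy(3)] by metis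
      then have wit: "\<exists>m. mdist X (x m) x0 > real n \<and>
          p (mdist X (x m) x0) = mdist X (x m) x0 powr (1 / real (Suc m))" for n
        using xy(3)[of n] by metis
      obtain r0 where r0: "\<And>z. z \<in> mspace X \<Longrightarrow> mdist X z x0 > r0 \<Longrightarrow>
          diameter (f ` mball_of X z (p (mdist X z x0))) < \<epsilon>"
        using h p \<open>\<epsilon> > 0\<close> unfolding higson_subpower_def by metis
      obtain n :: nat where "r0 < real n" using reals_Archimedean2 by blast
      then obtain m where m: "mdist X (x m) x0 > r0"
          "p (mdist X (x m) x0) = mdist X (x m) x0 powr (1 / real (Suc m))"
        using wit[of n] order.strict_trans by meson
      define B where "B = mball_of X (x m) (p (mdist X (x m) x0))"
      \<comment> \<open>A positive norm makes the radius positive, so the centre lies in its own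
        ball.\<close>
      have "m < mdist X (x m) x0" using xy(3) .
      then have "p (mdist X (x m) x0) > 0" using m(2) by simp
      then have "x m \<in> B" "y m \<in> B" "B \<subseteq> mspace X"
        using xy(1,2,4)[of m] m(2)
        by (auto simp: B_def mball_of_def Metric_space.in_mball[OF Metric_space_mspace_mdist]
              Metric_space.mdist_zero[OF Metric_space_mspace_mdist])
      then have "dist (f (x m)) (f (y m)) \<le> diameter (f ` B)"
        by (intro diameter_bounded_bound bdd) auto
      with r0[OF xy(1) m(1)] xy(5)[of m] show False
        by (simp add: B_def dist_real_def)
    qed
    with bc show "bounded_continuous (mtopology_of X) f \<and> ?R" by blast
  next
    assume "bounded_continuous (mtopology_of X) f \<and> ?R"
    then have R: ?R by blast
    have "\<exists>r0>0. \<forall>x\<in>mspace X. mdist X x x0 > r0 \<longrightarrow>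
           diameter (f ` mball_of X x (p (mdist X x x0))) < \<epsilon>"
      if p: "asymptotically_subpower p" and "\<epsilon> > 0" for p \<epsilon>
    proof -
      \<comment> \<open>Two points of the ball are compared through its centre; \<epsilon>/3 leaves
        room for the strict inequality, since a diameter is a supremum.\<close>
      have "\<epsilon> / 3 > 0" using \<open>\<epsilon> > 0\<close> by simp
      with R obtain \<alpha> r where "\<alpha> > 0" and r: "\<And>x y. x \<in> mspace X \<Longrightarrow> y \<in> mspace X \<Longrightarrow>
          mdist X x x0 > r \<Longrightarrow> mdist X x y < mdist X x x0 powr \<alpha> \<Longrightarrow> \<bar>f x - f y\<bar> < \<epsilon> / 3"
        by meson
      obtain t0 where t0: "t0 > 0" "\<And>t. t > t0 \<Longrightarrow> p t < t powr \<alpha>"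
        using p \<open>\<alpha> > 0\<close> unfolding asymptotically_subpower_def by meson
      show ?thesis
      proof (intro exI conjI ballI impI)
        show "max t0 r > 0" using t0 by simp
        fix x assume x: "x \<in> mspace X" and big: "mdist X x x0 > max t0 r"
        have near: "\<bar>f x - f y\<bar> < \<epsilon> / 3" if "y \<in> mball_of X x (p (mdist X x x0))" for y
          using that r[of x y] t0(2)[of "mdist X x x0"] big
          by (force simp: mball_of_def Metric_space.in_mball[OF Metric_space_mspace_mdist])
        have "diameter (f ` mball_of X x (p (mdist X x x0))) \<le> 2 * \<epsilon> / 3"
        proof (rule diameter_le)
          show "f ` mball_of X x (p (mdist X x x0)) \<noteq> {} \<or> 0 \<le> 2 * \<epsilon> / 3"
            using \<open>\<epsilon> > 0\<close> by simp
        next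
          fix u v assume "u \<in> f ` mball_of X x (p (mdist X x x0))"
            "v \<in> f ` mball_of X x (p (mdist X x x0))"
          then obtain y z where "u = f y" "v = f z" "\<bar>f x - f y\<bar> < \<epsilon> / 3" "\<bar>f x - f z\<bar> < \<epsilon> / 3"
            using near by blast
          then show "norm (u - v) \<le> 2 * \<epsilon> / 3" by (simp add: abs_real_def split: if_splits)
        qed
        then show "diameter (f ` mball_of X x (p (mdist X x x0))) < \<epsilon>"
          using \<open>\<epsilon> > 0\<close> by simp
      qed
    qed
    with bc show "higson_subpower X x0 f"
      by (simp add: higson_subpower_def)
  qed
next
  case False
  then show ?thesis by (simp add: higson_subpower_def)
qed

section \<open>The Higson subpower functions form a uniformly closed algebra\<close>

lemma higson_subpower_imp_bounded:
  assumes "higson_subpower X x0 f"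
  obtains B where "B > 0" "\<And>x. x \<in> mspace X \<Longrightarrow> \<bar>f x\<bar> \<le> B"
  using assms unfolding higson_subpower_def bounded_continuous_def
  by (auto simp: bounded_pos)

text \<open>Sums and products share this argument: the smaller exponent and the larger threshold
  serve both functions, and the Lipschitz-type bound passes the estimate on to
  \<open>h\<close>.\<close>

lemma higson_subpower_combine:
  assumes f: "higson_subpower X x0 f" and g: "higson_subpower X x0 g"
    and h: "bounded_continuous (mtopology_of X) h"
    and C: "C > 0" "\<And>x y. x \<in> mspace X \<Longrightarrow> y \<in> mspace X \<Longrightarrow>
      \<bar>h x - h y\<bar> \<le> C * (\<bar>f x - f y\<bar> + \<bar>g x - g y\<bar>)"
  shows "higson_subpower X x0 h"
  unfolding higson_subpower_iff
proof (intro conjI allI impI)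
  fix \<epsilon> :: real assume "\<epsilon> > 0"
  define \<delta> where "\<delta> = \<epsilon> / (2 * C)"
  have \<delta>: "\<delta> > 0" using \<open>\<epsilon> > 0\<close> \<open>C > 0\<close> by (simp add: \<delta>_def)
  obtain \<alpha> r where 1: "\<alpha> > 0" "\<And>x y. x \<in> mspace X \<Longrightarrow> y \<in> mspace X \<Longrightarrow>
      mdist X x x0 > r \<Longrightarrow> mdist X x y < mdist X x x0 powr \<alpha> \<Longrightarrow> \<bar>f x - f y\<bar> < \<delta>"
    using f \<delta> unfolding higson_subpower_iff by meson
  obtain \<beta> s where 2: "\<beta> > 0" "\<And>x y. x \<in> mspace X \<Longrightarrow> y \<in> mspace X \<Longrightarrow>
      mdist X x x0 > s \<Longrightarrow> mdist X x y < mdist X x x0 powr \<beta> \<Longrightarrow> \<bar>g x - g y\<bar> < \<delta>"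
    using g \<delta> unfolding higson_subpower_iff by meson
  show "\<exists>\<alpha>>0. \<exists>r. \<forall>x\<in>mspace X. \<forall>y\<in>mspace X. mdist X x x0 > r \<longrightarrow>
          mdist X x y < mdist X x x0 powr \<alpha> \<longrightarrow> \<bar>h x - h y\<bar> < \<epsilon>"
  proof (rule exI[of _ "min \<alpha> \<beta>"], intro conjI exI[of _ "max 1 (max r s)"] ballI impI)
    fix x y assume x: "x \<in> mspace X" and y: "y \<in> mspace X"
      and big: "mdist X x x0 > max 1 (max r s)"
      and near: "mdist X x y < mdist X x x0 powr min \<alpha> \<beta>"
    \<comment> \<open>Lowering the exponent lowers the power only for bases above 1, hence the 1 in
      the threshold.\<close>
    have "mdist X x x0 powr min \<alpha> \<beta> \<le> mdist X x x0 powr \<alpha>"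
      "mdist X x x0 powr min \<alpha> \<beta> \<le> mdist X x x0 powr \<beta>"
      using big by (auto intro: powr_mono)
    then have "\<bar>f x - f y\<bar> < \<delta>" "\<bar>g x - g y\<bar> < \<delta>"
      using 1(2)[OF x y] 2(2)[OF x y] big less_le_trans[OF near] by auto
    then have "C * (\<bar>f x - f y\<bar> + \<bar>g x - g y\<bar>) < C * (2 * \<delta>)"
      using \<open>C > 0\<close> by (intro mult_strict_left_mono) auto
    also have "\<dots> = \<epsilon>" using \<open>C > 0\<close> by (simp add: \<delta>_def)
    finally show "\<bar>h x - h y\<bar> < \<epsilon>" using C(2)[OF x y] by simp
  qed (use 1 2 in auto)
qed (rule h)

lemma bounded_continuous_add:
  assumes "bounded_continuous T f" "bounded_continuous T g"
  shows "bounded_continuous T (\<lambda>x. f x + g x)"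
  using assms by (auto simp: bounded_continuous_def intro: continuous_map_add bounded_plus_comp)

lemma bounded_continuous_mult:
  fixes f g :: "'a \<Rightarrow> real"
  assumes f: "bounded_continuous T f" and g: "bounded_continuous T g"
  shows "bounded_continuous T (\<lambda>x. f x * g x)"
proof -
  obtain A B where "A > 0" "B > 0" and AB: "\<And>x. x \<in> topspace T \<Longrightarrow> \<bar>f x\<bar> \<le> A"
      "\<And>x. x \<in> topspace T \<Longrightarrow> \<bar>g x\<bar> \<le> B"
    using f g unfolding bounded_continuous_def by (auto simp: bounded_pos)
  then have "\<bar>f x * g x\<bar> \<le> A * B" if "x \<in> topspace T" for x
    using that by (simp add: abs_mult mult_mono)
  then have "bounded ((\<lambda>x. f x * g x) ` topspace T)"
    by (auto simp: bounded_iff)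
  with f g show ?thesis
    by (auto simp: bounded_continuous_def intro: continuous_map_real_mult)
qed

lemma higson_subpower_const: "higson_subpower X x0 (\<lambda>_. c)"
  unfolding higson_subpower_iff bounded_continuous_def
  by (auto intro: exI[of _ 1] finite_imp_bounded simp: image_constant_conv)

lemma higson_subpower_add:
  assumes f: "higson_subpower X x0 f" and g: "higson_subpower X x0 g"
  shows "higson_subpower X x0 (\<lambda>x. f x + g x)"
proof (rule higson_subpower_combine[OF f g, of _ 1])
  show "bounded_continuous (mtopology_of X) (\<lambda>x. f x + g x)"
    using f g by (intro bounded_continuous_add) (auto simp: higson_subpower_def)
qed auto

lemma higson_subpower_mult:
  assumes f: "higson_subpower X x0 f" and g: "higson_subpower X x0 g"
  shows "higson_subpower X x0 (\<lambda>x. f x * g x)"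
proof -
  obtain A where A: "A > 0" "\<And>x. x \<in> mspace X \<Longrightarrow> \<bar>f x\<bar> \<le> A"
    using higson_subpower_imp_bounded[OF f] by blast
  obtain B where B: "B > 0" "\<And>x. x \<in> mspace X \<Longrightarrow> \<bar>g x\<bar> \<le> B"
    using higson_subpower_imp_bounded[OF g] by blast
  show ?thesis
  proof (rule higson_subpower_combine[OF f g, of _ "A + B"])
    show "bounded_continuous (mtopology_of X) (\<lambda>x. f x * g x)"
      using f g by (intro bounded_continuous_mult) (auto simp: higson_subpower_def)
    show "A + B > 0" using A B by simp
    fix x y assume x: "x \<in> mspace X" and y: "y \<in> mspace X"
    have "f x * g x - f y * g y = (f x - f y) * g x + f y * (g x - g y)"
      by (simp add: algebra_simps)
    then have "\<bar>f x * g x - f y * g y\<bar> \<le> \<bar>f x - f y\<bar> * \<bar>g x\<bar> + \<bar>f y\<bar> * \<bar>g x - g y\<bar>"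
      by (metis abs_mult abs_triangle_ineq)
    also have "\<dots> \<le> \<bar>f x - f y\<bar> * (A + B) + (A + B) * \<bar>g x - g y\<bar>"
      using A(1) B(1) A(2)[OF y] B(2)[OF x] by (intro add_mono mult_mono) auto
    finally show "\<bar>f x * g x - f y * g y\<bar> \<le> (A + B) * (\<bar>f x - f y\<bar> + \<bar>g x - g y\<bar>)"
      by (simp add: algebra_simps)
  qed
qed

lemma higson_subpower_uniform_limit:
  assumes f: "bounded_continuous (mtopology_of X) f"
    and lim: "\<And>\<epsilon>. \<epsilon> > 0 \<Longrightarrow> \<exists>h. higson_subpower X x0 h \<and> (\<forall>x\<in>mspace X. \<bar>f x - h x\<bar> < \<epsilon>)"
  shows "higson_subpower X x0 f"
  unfolding higson_subpower_iff
proof (intro conjI allI impI)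
  fix \<epsilon> :: real assume "\<epsilon> > 0"
  then have e3: "\<epsilon> / 3 > 0" by simp
  obtain h where h: "higson_subpower X x0 h" "\<And>x. x \<in> mspace X \<Longrightarrow> \<bar>f x - h x\<bar> < \<epsilon> / 3"
    using lim[OF e3] by blast
  obtain \<alpha> r where 1: "\<alpha> > 0" "\<And>x y. x \<in> mspace X \<Longrightarrow> y \<in> mspace X \<Longrightarrow>
      mdist X x x0 > r \<Longrightarrow> mdist X x y < mdist X x x0 powr \<alpha> \<Longrightarrow> \<bar>h x - h y\<bar> < \<epsilon> / 3"
    using h(1) e3 unfolding higson_subpower_iff by meson
  have "\<bar>f x - f y\<bar> < \<epsilon>" if "x \<in> mspace X" "y \<in> mspace X"
      "mdist X x x0 > r" "mdist X x y < mdist X x x0 powr \<alpha>" for x y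
    using 1(2)[OF that] h(2)[OF that(1)] h(2)[OF that(2)] by (simp add: abs_real_def split: if_splits)
  with 1(1) show "\<exists>\<alpha>>0. \<exists>r. \<forall>x\<in>mspace X. \<forall>y\<in>mspace X. mdist X x x0 > r \<longrightarrow>
          mdist X x y < mdist X x x0 powr \<alpha> \<longrightarrow> \<bar>f x - f y\<bar> < \<epsilon>"
    by blast
qed (rule f)

section \<open>The compactification as a closure in a product of lines\<close>

text \<open>All functions index the product of lines; the coordinates that are not Higson subpower are
  constantly 0 and carry no information.\<close>
definition higson_eval :: "'a metric \<Rightarrow> 'a \<Rightarrow> 'a \<Rightarrow> ('a \<Rightarrow> real) \<Rightarrow> real" where
  "higson_eval X x0 x f = (if higson_subpower X x0 f then f x else 0)"

definition higson_points :: "'a metric \<Rightarrow> 'a \<Rightarrow> (('a \<Rightarrow> real) \<Rightarrow> real) set" where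
  "higson_points X x0 = closure (higson_eval X x0 ` mspace X)"

lemma higson_eval_in_points: "x \<in> mspace X \<Longrightarrow> higson_eval X x0 x \<in> higson_points X x0"
  unfolding higson_points_def by (rule subsetD[OF closure_subset]) (rule imageI)

text \<open>The density principle: a closed condition needs checking only at the points of the
  space.\<close>

lemma higson_points_minimal:
  assumes "closed C" "\<And>x. x \<in> mspace X \<Longrightarrow> higson_eval X x0 x \<in> C"
  shows "higson_points X x0 \<subseteq> C"
  unfolding higson_points_def using assms by (intro closure_minimal) auto

lemma continuous_on_coordinate: "continuous_on S (\<lambda>z :: 'a \<Rightarrow> 'b::topological_space. z f)"
  by (rule continuous_on_subset[OF continuous_on_product_coordinates]) simp

lemma closed_coordinate:
  fixes C :: "real set"
  assumes "closed C"
  shows "closed {z :: 'a \<Rightarrow> real. z f \<in> C}"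
  using closed_vimage[OF assms, of "\<lambda>z. z f"] by (simp add: vimage_def)

lemma open_coordinate_nonzero: "open {z :: 'a \<Rightarrow> real. z f \<in> - {0}}"
  using open_vimage_apply[OF open_Compl[OF closed_singleton[of "0::real"]], of f]
  by (simp only: vimage_def)

lemma higson_points_coordinate:
  assumes "higson_subpower X x0 f" "closed C" "\<And>x. x \<in> mspace X \<Longrightarrow> f x \<in> C"
    and "z \<in> higson_points X x0"
  shows "z f \<in> C"
proof -
  have "higson_points X x0 \<subseteq> {z. z f \<in> C}"
    by (rule higson_points_minimal[OF closed_coordinate[OF assms(2)]])
      (simp add: higson_eval_def assms(1,3))
  then show ?thesis using assms(4) by blast
qed

text \<open>Ensures that distinct points of the closure differ at a Higson subpower coordinate, as
  needed for separating points in Stone-Weierstrass.\<close>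

lemma higson_points_junk:
  assumes "\<not> higson_subpower X x0 f" "z \<in> higson_points X x0"
  shows "z f = 0"
proof -
  have "higson_points X x0 \<subseteq> {z. z f \<in> {0}}"
    by (rule higson_points_minimal[OF closed_coordinate]) (simp_all add: higson_eval_def assms(1))
  then show ?thesis using assms(2) by blast
qed

text \<open>Tychonoff: every coordinate is bounded on the space, so the closure is a closed subset
  of a product of compact sets.\<close>

lemma compact_higson_points: "compact (higson_points X x0)"
proof -
  define B where "B f = closure ((\<lambda>x. higson_eval X x0 x f) ` mspace X)" for f
  have "bounded ((\<lambda>x. higson_eval X x0 x f) ` mspace X)" for f
  proof (cases "higson_subpower X x0 f")
    case True
    then have "bounded (f ` mspace X)" by (simp add: higson_subpower_def bounded_continuous_def)
    with True show ?thesis by (simp add: higson_eval_def)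
  next
    case False
    then show ?thesis by (simp add: higson_eval_def image_constant_conv)
  qed
  then have "compact (B f)" for f by (simp add: B_def compact_closure)
  then have "compactin (product_topology (\<lambda>_. euclidean) UNIV) (PiE UNIV B)"
    by (simp add: compactin_PiE)
  then have comp: "compact (PiE UNIV B)"
    by (simp add: euclidean_product_topology)
  have "higson_points X x0 \<subseteq> PiE UNIV B"
  proof (rule higson_points_minimal)
    show "closed (PiE UNIV B)" using comp by (rule compact_imp_closed)
    fix x assume "x \<in> mspace X"
    then have "higson_eval X x0 x f \<in> B f" for f
      using closure_subset[of "(\<lambda>x. higson_eval X x0 x f) ` mspace X"] unfolding B_def by blast
    then show "higson_eval X x0 x \<in> PiE UNIV B" by (simp add: PiE_UNIV_domain)
  qed
  then have "PiE UNIV B \<inter> higson_points X x0 = higson_points X x0" by blast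
  moreover have "closed (higson_points X x0)" unfolding higson_points_def by (rule closed_closure)
  ultimately show ?thesis
    using compact_Int_closed[OF comp, of "higson_points X x0"] by simp
qed

lemma continuous_map_higson_eval:
  "continuous_map (mtopology_of X) euclidean (higson_eval X x0)"
proof -
  have "continuous_map (mtopology_of X) euclideanreal (\<lambda>x. higson_eval X x0 x f)" for f
  proof (cases "higson_subpower X x0 f")
    case True
    then have "continuous_map (mtopology_of X) euclideanreal f"
      by (simp add: higson_subpower_def bounded_continuous_def)
    with True show ?thesis by (simp add: higson_eval_def)
  next
    case False
    then show ?thesis by (simp add: higson_eval_def)
  qed
  then show ?thesis
    unfolding euclidean_product_topology[symmetric] by (simp add: continuous_map_componentwise_UNIV)
qed

lemma bounded_continuous_higson_points:
  fixes g :: "(('a \<Rightarrow> real) \<Rightarrow> real) \<Rightarrow> real"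
  assumes g: "continuous_on (higson_points X x0) g"
  shows "bounded_continuous (mtopology_of X) (\<lambda>x. g (higson_eval X x0 x))"
  unfolding bounded_continuous_def
proof
  have "continuous_map (mtopology_of X) (top_of_set (higson_points X x0)) (higson_eval X x0)"
    by (simp add: continuous_map_in_subtopology continuous_map_higson_eval higson_eval_in_points
        image_subset_iff)
  moreover have "continuous_map (top_of_set (higson_points X x0)) euclideanreal g"
    using g by simp
  ultimately show "continuous_map (mtopology_of X) euclideanreal (\<lambda>x. g (higson_eval X x0 x))"
    using continuous_map_compose[of "mtopology_of X" _ "higson_eval X x0" euclideanreal g]
    by (simp add: o_def)
  have "bounded (g ` higson_points X x0)"
    using compact_continuous_image[OF g compact_higson_points] by (rule compact_imp_bounded)
  then show "bounded ((\<lambda>x. g (higson_eval X x0 x)) ` topspace (mtopology_of X))"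
    by (rule bounded_subset) (auto simp: higson_eval_in_points)
qed

text \<open>By Stone--Weierstrass, polynomials in the coordinates are uniformly dense in the continuous
  functions, and the Higson functions form a uniformly closed algebra.\<close>
lemma continuous_on_higson_points_imp_higson:
  assumes g: "continuous_on (higson_points X x0) g"
  shows "higson_subpower X x0 (\<lambda>x. g (higson_eval X x0 x))"
proof -
  define R where "R = {h. continuous_on (higson_points X x0) h \<and>
    higson_subpower X x0 (\<lambda>x. h (higson_eval X x0 x))}"
  interpret function_ring_on R "higson_points X x0"
  proof
    show "compact (higson_points X x0)" by (rule compact_higson_points)
    show "\<exists>f\<in>R. f z \<noteq> f w"
      if z: "z \<in> higson_points X x0" and w: "w \<in> higson_points X x0" and "z \<noteq> w" for z w
    proof -
      \<comment> \<open>Coordinate projections separate points, and a projection lies in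
        \<open>R\<close> because its restriction to the space is the Higson function
        \<open>f\<close> itself.\<close>
      obtain f where f: "z f \<noteq> w f" using \<open>z \<noteq> w\<close> by blast
      then have h: "higson_subpower X x0 f"
        using higson_points_junk[OF _ z, of f] higson_points_junk[OF _ w, of f] by force
      have "(\<lambda>z. z f) \<in> R"
        using h continuous_on_coordinate by (simp add: R_def higson_eval_def)
      with f show ?thesis by (intro bexI[of _ "\<lambda>z. z f"])
    qed
  next
    fix f g assume "f \<in> R" "g \<in> R"
    then show "(\<lambda>z. f z + g z) \<in> R" "(\<lambda>z. f z * g z) \<in> R"
      by (simp_all add: R_def continuous_on_add continuous_on_mult higson_subpower_add
          higson_subpower_mult)
  qed (simp_all add: R_def higson_subpower_const)
  show ?thesis
  proof (rule higson_subpower_uniform_limit)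
    show "bounded_continuous (mtopology_of X) (\<lambda>x. g (higson_eval X x0 x))"
      using g by (rule bounded_continuous_higson_points)
    fix \<epsilon> :: real assume "\<epsilon> > 0"
    then obtain h where "h \<in> R" "\<forall>z\<in>higson_points X x0. \<bar>g z - h z\<bar> < \<epsilon>"
      using Stone_Weierstrass_basic[OF g] by blast
    then show "\<exists>h. higson_subpower X x0 h \<and>
        (\<forall>x\<in>mspace X. \<bar>g (higson_eval X x0 x) - h x\<bar> < \<epsilon>)"
      by (auto simp: R_def higson_eval_in_points)
  qed
qed

section \<open>Spaces whose points are isolated in the compactification\<close>

text \<open>The coordinate at the indicator of a vanishes at the image of every other point of the
  space. By density, all points of the closure except the image of a satisfy this closed
  condition.\<close>

lemma higson_points_isolated:
  assumes h: "higson_subpower X x0 (indicator {a})" and a: "a \<in> mspace X"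
  shows "{higson_eval X x0 a} = higson_points X x0 \<inter> {z. z (indicator {a}) \<in> - {0}}"
proof -
  have "higson_points X x0 \<subseteq> {higson_eval X x0 a} \<union> {z. z (indicator {a}) \<in> {0}}"
  proof (rule higson_points_minimal)
    show "closed ({higson_eval X x0 a} \<union> {z. z (indicator {a}) \<in> {0}})"
      by (intro closed_Un closed_coordinate) auto
    show "higson_eval X x0 x \<in> {higson_eval X x0 a} \<union> {z. z (indicator {a}) \<in> {0}}" for x
      using h by (cases "x = a") (auto simp: higson_eval_def)
  qed
  moreover have "higson_eval X x0 a (indicator {a}) \<notin> {0}"
    using h by (simp add: higson_eval_def)
  ultimately show ?thesis using higson_eval_in_points[OF a, of x0] by blast
qed

lemma openin_higson_points_isolated:
  assumes h: "higson_subpower X x0 (indicator {a})" and a: "a \<in> mspace X"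
  shows "openin (top_of_set (higson_points X x0)) {higson_eval X x0 a}"
  unfolding higson_points_isolated[OF assms] by (rule openin_open_Int[OF open_coordinate_nonzero])

lemma inj_on_higson_eval:
  assumes h: "\<And>a. a \<in> mspace X \<Longrightarrow> higson_subpower X x0 (indicator {a})"
  shows "inj_on (higson_eval X x0) (mspace X)"
proof (rule inj_onI)
  fix x y assume "x \<in> mspace X" and e: "higson_eval X x0 x = higson_eval X x0 y"
  then have "higson_subpower X x0 (indicator {x})" using h by simp
  then show "x = y" using fun_cong[OF e, of "indicator {x}"]
    by (auto simp: higson_eval_def indicator_def split: if_splits)
qed

text \<open>The hypothesis makes all image points isolated, so every subset of the image is open and
  the evaluation is an open map. A Higson function extends by its own coordinate; the converse is
  the Stone-Weierstrass lemma above.\<close>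

lemma higson_subpower_compactification_higson_points:
  assumes h: "\<And>a. a \<in> mspace X \<Longrightarrow> higson_subpower X x0 (indicator {a})"
  shows "higson_subpower_compactification X x0 (top_of_set (higson_points X x0)) (higson_eval X x0)"
    (is "higson_subpower_compactification X x0 ?K ?e")
  unfolding higson_subpower_compactification_def hausdorff_compactification_def
proof (intro conjI allI impI)
  show "compact_space ?K"
    by (simp add: compact_higson_points compact_space_subtopology)
  have "Hausdorff_space (euclidean :: (('a \<Rightarrow> real) \<Rightarrow> real) topology)"
    unfolding euclidean_product_topology[symmetric]
    by (simp add: Hausdorff_space_product_topology)
  then show "Hausdorff_space ?K"
    by (rule Hausdorff_space_subtopology)
  show "embedding_map (mtopology_of X) ?K ?e"
  proof (rule injective_open_imp_embedding_map)
    show "continuous_map (mtopology_of X) ?K ?e"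
      by (simp add: continuous_map_in_subtopology continuous_map_higson_eval higson_eval_in_points
          image_subset_iff)
    show "open_map (mtopology_of X) ?K ?e"
      unfolding open_map_def
    proof (intro allI impI)
      fix U assume "openin (mtopology_of X) U"
      then have "U \<subseteq> mspace X" using openin_subset by fastforce
      then have "openin ?K (\<Union>a\<in>U. {?e a})"
        by (intro openin_Union) (auto intro!: openin_higson_points_isolated h)
      then show "openin ?K (?e ` U)" by (simp add: UNION_singleton_eq_range)
    qed
    show "inj_on ?e (topspace (mtopology_of X))"
      using inj_on_higson_eval[OF h] by simp
  qed
  have "higson_points X x0 \<inter> ?e ` mspace X = ?e ` mspace X"
    using higson_eval_in_points by fastforce
  then show "?K closure_of (?e ` topspace (mtopology_of X)) = topspace ?K"
    by (simp add: closure_of_subtopology higson_points_def)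
next
  fix f assume "bounded_continuous (mtopology_of X) f"
  show "(\<exists>g. continuous_map ?K euclideanreal g \<and> (\<forall>x\<in>mspace X. g (?e x) = f x)) \<longleftrightarrow>
      higson_subpower X x0 f"
  proof
    assume "\<exists>g. continuous_map ?K euclideanreal g \<and> (\<forall>x\<in>mspace X. g (?e x) = f x)"
    then obtain g where g: "continuous_on (higson_points X x0) g"
      "\<And>x. x \<in> mspace X \<Longrightarrow> g (?e x) = f x"
      by auto
    \<comment> \<open>\<open>f\<close> agrees with the restriction of \<open>g\<close> only on
      \<open>mspace X\<close>; approximation with error 0 carries the property over to
      \<open>f\<close>.\<close>
    show "higson_subpower X x0 f"
    proof (rule higson_subpower_uniform_limit)
      show "\<exists>h. higson_subpower X x0 h \<and> (\<forall>x\<in>mspace X. \<bar>f x - h x\<bar> < \<epsilon>)" if "\<epsilon> > 0" for \<epsilon>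
        using continuous_on_higson_points_imp_higson[OF g(1)] g(2) that
        by (intro exI[of _ "\<lambda>x. g (?e x)"]) auto
    qed fact
  next
    assume f: "higson_subpower X x0 f"
    show "\<exists>g. continuous_map ?K euclideanreal g \<and> (\<forall>x\<in>mspace X. g (?e x) = f x)"
      using f continuous_on_coordinate by (intro exI[of _ "\<lambda>z. z f"]) (simp add: higson_eval_def)
  qed
qed

text \<open>Compactness gives a limit point of the infinite image, and an isolated image point
  cannot be a limit point.\<close>

lemma higson_corona_cluster:
  assumes h: "\<And>a. a \<in> mspace X \<Longrightarrow> higson_subpower X x0 (indicator {a})"
    and P: "P \<subseteq> mspace X" "infinite P"
  obtains z where "z \<in> higson_points X x0 - higson_eval X x0 ` mspace X"
    "z \<in> closure (higson_eval X x0 ` P)"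
proof -
  let ?e = "higson_eval X x0"
  have "infinite (?e ` P)"
    using P(2) finite_imageD[OF _ inj_on_subset[OF inj_on_higson_eval[OF h] P(1)]] by blast
  moreover have "?e ` P \<subseteq> higson_points X x0"
    using P(1) by (auto intro: higson_eval_in_points)
  ultimately obtain z where z: "z \<in> higson_points X x0" "z islimpt ?e ` P"
    using Heine_Borel_imp_Bolzano_Weierstrass[OF compact_higson_points] by meson
  have "z \<noteq> ?e a" if a: "a \<in> mspace X" for a
  proof
    assume "z = ?e a"
    obtain U where U: "open U" "{?e a} = higson_points X x0 \<inter> U"
      using openin_higson_points_isolated[OF h[OF a] a] unfolding openin_open by blast
    then have "z \<in> U" using \<open>z = ?e a\<close> by blast
    then obtain w where "w \<in> ?e ` P" "w \<in> U" "w \<noteq> z"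
      using islimptE[OF z(2) _ U(1)] by metis
    then show False
      using U(2) \<open>z = ?e a\<close> \<open>?e ` P \<subseteq> higson_points X x0\<close> by blast
  qed
  then have "z \<in> higson_points X x0 - ?e ` mspace X" using z(1) by blast
  moreover have "z \<in> closure (?e ` P)" using z(2) by (simp add: closure_def)
  ultimately show thesis by (rule that)
qed

text \<open>The image is a union of isolated points, hence open, and its complement is closed in a
  compact set.\<close>

lemma compact_higson_corona:
  assumes h: "\<And>a. a \<in> mspace X \<Longrightarrow> higson_subpower X x0 (indicator {a})"
  shows "compact (higson_points X x0 - higson_eval X x0 ` mspace X)"
proof -
  have "openin (top_of_set (higson_points X x0)) (\<Union>a\<in>mspace X. {higson_eval X x0 a})"
    by (intro openin_Union) (auto intro!: openin_higson_points_isolated h)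
  then have "openin (top_of_set (higson_points X x0)) (higson_eval X x0 ` mspace X)"
    by (simp add: UNION_singleton_eq_range)
  then have "closedin (top_of_set (higson_points X x0))
      (higson_points X x0 - higson_eval X x0 ` mspace X)"
    by (simp add: closedin_def double_diff higson_eval_in_points image_subset_iff)
  then show ?thesis
    by (rule closedin_compact[OF compact_higson_points])
qed

section \<open>The space of pairs and its distances\<close>

text \<open>Since \<open>prod_decode\<close> is a bijection onto pairs of naturals, each index
  recurs for arbitrarily large j.\<close>

definition pair_index :: "nat \<Rightarrow> nat" where
  "pair_index j = fst (prod_decode j)"

definition left_point :: "nat \<Rightarrow> real" where
  "left_point j = 4 ^ Suc j"

definition right_point :: "nat \<Rightarrow> real" where
  "right_point j = left_point j + left_point j powr (1 / (real (pair_index j) + 2))"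

definition pair_set :: "real set" where
  "pair_set = insert 0 (range left_point \<union> range right_point)"

definition pair_space :: "real metric" where
  "pair_space = submetric euclidean_metric pair_set"

lemma mspace_pair_space [simp]: "mspace pair_space = pair_set"
  and mdist_pair_space [simp]: "mdist pair_space = dist"
  by (simp_all add: pair_space_def)

lemma left_point_ge: "4 \<le> left_point j"
  by (simp add: left_point_def)

lemma left_point_ge_index: "real j \<le> left_point j"
proof -
  have "real j < 2 ^ j" by (rule of_nat_less_two_power)
  also have "(2::real) ^ j \<le> 4 ^ j" by (rule power_mono) auto
  also have "\<dots> \<le> left_point j" by (simp add: left_point_def)
  finally show ?thesis by simp
qed

lemma right_point_gt: "left_point j < right_point j"
  using left_point_ge[of j] by (simp add: right_point_def)

text \<open>The summand 2 in \<open>right_point\<close> keeps the exponent at most 1/2, and the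
  square root of a is at most a/2 once a \<ge> 4.\<close>

lemma right_point_le: "right_point j \<le> 3/2 * left_point j"
proof -
  have "left_point j powr (1 / (real (pair_index j) + 2)) \<le> left_point j powr (1/2)"
    using left_point_ge[of j] by (intro powr_mono) (auto simp: divide_simps)
  also have "\<dots> = sqrt (left_point j)"
    using left_point_ge[of j] by (simp add: powr_half_sqrt)
  also have "\<dots> \<le> left_point j / 2"
  proof (rule real_le_lsqrt)
    have "4 * left_point j \<le> left_point j * left_point j"
      using left_point_ge[of j] by (intro mult_right_mono) auto
    then show "left_point j \<le> (left_point j / 2)\<^sup>2" by (simp add: power2_eq_square)
  qed (use left_point_ge[of j] in auto)
  finally show ?thesis by (simp add: right_point_def)
qed

lemma left_point_less:
  assumes "j < k"
  shows "4 * left_point j \<le> left_point k"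
proof -
  have "(4::real) ^ Suc (Suc j) \<le> 4 ^ Suc k"
    using assms by (intro power_increasing) auto
  then show ?thesis by (simp add: left_point_def)
qed

lemma pair_set_cases:
  assumes "x \<in> pair_set"
  obtains "x = 0" | j where "x = left_point j \<or> x = right_point j"
    "left_point j \<le> x" "x \<le> 3/2 * left_point j"
  using assms right_point_gt right_point_le left_point_ge unfolding pair_set_def
  by (smt (verit) UnE insertE rangeE)

text \<open>A pair lies between a and 3a/2 while the next one starts at 4a or later. Points of
  different pairs are therefore at a distance proportional to the larger one; 1/4 is a convenient
  constant.\<close>

lemma pair_set_distinct:
  assumes x: "x \<in> pair_set" and y: "y \<in> pair_set" and "x \<noteq> y"
  shows "(\<exists>j. {x, y} = {left_point j, right_point j}) \<or> max x y / 4 \<le> dist x y"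
  using x
proof (cases rule: pair_set_cases)
  case x: 1
  show ?thesis
    using y
  proof (cases rule: pair_set_cases)
    case 1
    then show ?thesis using x \<open>x \<noteq> y\<close> by simp
  next
    case (2 j)
    then show ?thesis using x left_point_ge[of j] by (auto simp: dist_real_def max_def)
  qed
next
  case x: (2 j)
  show ?thesis
    using y
  proof (cases rule: pair_set_cases)
    case 1
    then show ?thesis using x left_point_ge[of j] by (auto simp: dist_real_def max_def)
  next
    case y: (2 k)
    consider "j = k" | "j < k" | "k < j" by linarith
    then show ?thesis
    proof cases
      case 1
      then have "{x, y} = {left_point j, right_point j}" using x(1) y(1) \<open>x \<noteq> y\<close> by auto
      then show ?thesis by blast
    next
      case 2
      then show ?thesis using x(2,3) y(2,3) left_point_less[OF 2] left_point_ge[of j]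
        by (auto simp: dist_real_def max_def abs_real_def)
    next
      case 3
      then show ?thesis using x(2,3) y(2,3) left_point_less[OF 3] left_point_ge[of k]
        by (auto simp: dist_real_def max_def abs_real_def)
    qed
  qed
qed

text \<open>The unordered form allows either member of the pair to serve as the centre of a
  ball.\<close>

lemma pair_dist:
  assumes "{x, y} = {left_point j, right_point j}"
  shows "dist x y = left_point j powr (1 / (real (pair_index j) + 2))"
    and "left_point j \<le> x" "x \<le> 3/2 * left_point j"
proof -
  have "x = left_point j \<and> y = right_point j \<or> x = right_point j \<and> y = left_point j"
    using assms by (simp add: doubleton_eq_iff)
  then show "dist x y = left_point j powr (1 / (real (pair_index j) + 2))"
    and "left_point j \<le> x" "x \<le> 3/2 * left_point j"
    using right_point_gt[of j] right_point_le[of j] left_point_ge[of j]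
    by (auto simp: dist_real_def right_point_def)
qed

lemma pair_set_separated:
  assumes x: "x \<in> pair_set" and y: "y \<in> pair_set" and "x \<noteq> y"
  shows "1 \<le> dist x y"
proof (cases "\<exists>j. {x, y} = {left_point j, right_point j}")
  case True
  then obtain j where "{x, y} = {left_point j, right_point j}" by blast
  then show ?thesis
    using pair_dist(1) left_point_ge[of j] ge_one_powr_ge_zero[of "left_point j"] by simp
next
  case False
  then have "max x y / 4 \<le> dist x y" using pair_set_distinct[OF assms] by blast
  moreover have "z = 0 \<or> 4 \<le> z" if "z \<in> pair_set" for z
    using that left_point_ge by (cases rule: pair_set_cases) (auto intro: order_trans)
  then have "4 \<le> max x y" using x y \<open>x \<noteq> y\<close> by (metis le_max_iff_disj)
  ultimately show ?thesis by linarith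
qed

text \<open>The gap of a pair at \<open>a\<close> with index \<open>m\<close> is \<open>a powr (1 / (m + 2))\<close>, so balls of radius
  \<open>x powr (1 / (2 * n + 4))\<close> meet only pairs of index above \<open>n\<close>.\<close>
lemma pair_set_close:
  assumes x: "x \<in> pair_set" and y: "y \<in> pair_set" and "x \<noteq> y" and "16 < x"
    and near: "dist x y < x powr (1 / (2 * real n + 4))"
  obtains j where "n < pair_index j" "{x, y} = {left_point j, right_point j}"
proof -
  \<comment> \<open>For x > 16 the radius is at most sqrt x \<le> x/4, which rules out the far
    alternative of \<open>pair_set_distinct\<close>.\<close>
  have "x powr (1 / (2 * real n + 4)) \<le> x powr (1/2)"
    using \<open>16 < x\<close> by (intro powr_mono) (auto simp: divide_simps)
  also have "\<dots> = sqrt x"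
    using \<open>16 < x\<close> by (simp add: powr_half_sqrt)
  also have "\<dots> \<le> x / 4"
  proof (rule real_le_lsqrt)
    have "16 * x \<le> x * x"
      using \<open>16 < x\<close> by (intro mult_right_mono) auto
    then show "x \<le> (x / 4)\<^sup>2" by (simp add: power2_eq_square)
  qed (use \<open>16 < x\<close> in auto)
  finally have "\<not> max x y / 4 \<le> dist x y" using near by simp
  then obtain j where j: "{x, y} = {left_point j, right_point j}"
    using pair_set_distinct[OF x y \<open>x \<noteq> y\<close>] by blast
  have L: "4 \<le> left_point j" by (rule left_point_ge)
  \<comment> \<open>The centre x may be the right point. The bound x \<le> a^2 for the left point a
    covers both cases, and the square is absorbed by the factor 2 in 2n+4.\<close>
  have "4 * left_point j \<le> left_point j * left_point j"
    using L by (intro mult_right_mono) auto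
  then have "x \<le> left_point j * left_point j"
    using pair_dist(3)[OF j] L by linarith
  then have "x \<le> left_point j powr 2"
    using L by (simp add: power2_eq_square)
  then have "x powr (1 / (2 * real n + 4)) \<le> (left_point j powr 2) powr (1 / (2 * real n + 4))"
    using \<open>16 < x\<close> by (intro powr_mono2) auto
  also have "\<dots> = left_point j powr (1 / (real n + 2))"
  proof -
    have "2 * (1 / (2 * real n + 4)) = 1 / (real n + 2)" by (simp add: divide_simps)
    then show ?thesis by (simp only: powr_powr)
  qed
  finally have "left_point j powr (1 / (real (pair_index j) + 2)) < left_point j powr (1 / (real n + 2))"
    using near pair_dist(1)[OF j] by simp
  then have "1 / (real (pair_index j) + 2) < 1 / (real n + 2)"
    using L by simp
  then have "n < pair_index j" by (simp add: field_simps)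
  then show thesis using j that by blast
qed

section \<open>Topology and Higson subpower indicators of the pair space\<close>

lemma mtopology_of_pair_space: "mtopology_of pair_space = discrete_topology pair_set"
proof -
  have "openin (top_of_set pair_set) {x}" if "x \<in> pair_set" for x
  proof -
    have "{x} = pair_set \<inter> ball x 1"
      using that pair_set_separated[OF that] unfolding ball_def
      by (auto simp: not_less[symmetric])
    then show ?thesis by (metis open_ball openin_open_Int)
  qed
  then show ?thesis
    unfolding pair_space_def mtopology_of_submetric mtopology_of_euclidean
    by (metis discrete_topology_unique topspace_euclidean_subtopology)
qed

text \<open>The set may split pairs of index at most n only. Far out, a ball with exponent 1/(2n+4)
  contains besides its centre at most a partner of index above n, so the indicator is constant on
  it.\<close>

lemma higson_subpower_indicator:
  assumes "\<And>j. n < pair_index j \<Longrightarrow> left_point j \<in> A \<longleftrightarrow> right_point j \<in> A"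
  shows "higson_subpower pair_space 0 (indicator A)"
  unfolding higson_subpower_iff
proof (intro conjI allI impI)
  have "bounded (indicat_real A ` pair_set)"
    by (rule boundedI[of _ 1]) (auto simp: indicator_def)
  then show "bounded_continuous (mtopology_of pair_space) (indicat_real A)"
    by (simp add: bounded_continuous_def mtopology_of_pair_space)
  fix \<epsilon> :: real assume "\<epsilon> > 0"
  have "indicat_real A x = indicat_real A y"
    if x: "x \<in> pair_set" and y: "y \<in> pair_set" and "16 < dist x 0"
      and near: "dist x y < dist x 0 powr (1 / (2 * real n + 4))" for x y
  proof (cases "x = y")
    case False
    have "0 \<le> x" using x left_point_ge by (cases rule: pair_set_cases) (auto intro: order_trans)
    then have "16 < x" "dist x y < x powr (1 / (2 * real n + 4))"
      using that(3,4) by (auto simp: dist_real_def)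
    then obtain j where "n < pair_index j" "{x, y} = {left_point j, right_point j}"
      using pair_set_close[OF x y False] by blast
    then show ?thesis using assms[of j] by (auto simp: doubleton_eq_iff indicator_def)
  qed simp
  then show "\<exists>\<alpha>>0. \<exists>r. \<forall>x\<in>mspace pair_space. \<forall>y\<in>mspace pair_space.
      mdist pair_space x 0 > r \<longrightarrow> mdist pair_space x y < mdist pair_space x 0 powr \<alpha> \<longrightarrow>
      \<bar>indicat_real A x - indicat_real A y\<bar> < \<epsilon>"
    using \<open>\<epsilon> > 0\<close>
    by (intro exI[of _ "1 / (2 * real n + 4)"] exI[of _ 16] conjI) simp_all
qed

lemma inj_left_point: "inj left_point"
  by (rule injI) (simp add: left_point_def)

lemma inj_right_point: "inj right_point"
proof (rule linorder_injI)
  fix j k :: nat assume "j < k"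
  then show "right_point j \<noteq> right_point k"
    using left_point_less[of j k] right_point_le[of j] right_point_gt[of k] left_point_ge[of j]
    by linarith
qed

lemma left_point_neq_right_point: "left_point j \<noteq> right_point k"
proof -
  consider "j = k" | "j < k" | "k < j" by linarith
  then show ?thesis
    using left_point_less[of j k] left_point_less[of k j] right_point_le[of k] right_point_gt[of k]
      left_point_ge[of j] left_point_ge[of k]
    by cases auto
qed

lemma higson_subpower_indicator_singleton:
  assumes "a \<in> pair_set"
  shows "higson_subpower pair_space 0 (indicator {a})"
proof -
  \<comment> \<open>For a = 0 any j will do. In every case a singleton splits no pair of index above
    that of pair j.\<close>
  obtain j where "a = 0 \<or> a = left_point j \<or> a = right_point j"
    using assms by (auto simp: pair_set_def)
  moreover have "left_point k \<noteq> 0" "right_point k \<noteq> 0" for k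
    using left_point_ge[of k] right_point_gt[of k] by auto
  ultimately have "left_point k \<noteq> a" "right_point k \<noteq> a" if "pair_index j < pair_index k" for k
    using that inj_eq[OF inj_left_point] inj_eq[OF inj_right_point] left_point_neq_right_point
    by (metis less_irrefl)+
  then show ?thesis
    by (intro higson_subpower_indicator[of "pair_index j"]) simp
qed

text \<open>Left points dominate their position j, so a bound on the point bounds j. Bounded sets
  are thus finite, which makes the space proper.\<close>

lemma finite_pair_set_le: "finite {x \<in> pair_set. x \<le> M}"
proof -
  have "{x \<in> pair_set. x \<le> M} \<subseteq>
      insert 0 (left_point ` {..nat \<lceil>M\<rceil>} \<union> right_point ` {..nat \<lceil>M\<rceil>})"
  proof
    fix x assume "x \<in> {x \<in> pair_set. x \<le> M}"
    then have x: "x \<in> pair_set" "x \<le> M" by auto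
    from x(1) show "x \<in> insert 0 (left_point ` {..nat \<lceil>M\<rceil>} \<union> right_point ` {..nat \<lceil>M\<rceil>})"
    proof (cases rule: pair_set_cases)
      case (2 j)
      then have "real j \<le> M" using left_point_ge_index[of j] x(2) by linarith
      then have "j \<le> nat \<lceil>M\<rceil>" by linarith
      then show ?thesis using 2(1) by auto
    qed simp
  qed
  then show ?thesis by (rule finite_subset) simp
qed

lemma mbounded_pair_space:
  assumes "Metric_space.mbounded (mspace pair_space) (mdist pair_space) S"
  shows "\<exists>c B. \<forall>x\<in>S. x \<in> pair_set \<and> dist c x \<le> B"
proof -
  interpret Metric_space "mspace pair_space" "mdist pair_space"
    by (rule Metric_space_mspace_mdist)
  obtain c B where "S \<subseteq> mcball c B" using assms unfolding mbounded_def by blast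
  then have "\<forall>x\<in>S. x \<in> mspace pair_space \<and> mdist pair_space c x \<le> B"
    unfolding subset_iff in_mcball by blast
  then show ?thesis by auto
qed

lemma proper_pair_space: "proper_metric pair_space"
  unfolding proper_metric_def
proof (intro allI impI, elim conjE)
  fix S assume S: "closedin (mtopology_of pair_space) S"
    and "Metric_space.mbounded (mspace pair_space) (mdist pair_space) S"
  then obtain c B where "\<And>x. x \<in> S \<Longrightarrow> x \<in> pair_set \<and> dist c x \<le> B"
    using mbounded_pair_space by metis
  then have "S \<subseteq> {x \<in> pair_set. x \<le> \<bar>c\<bar> + B}"
    by (force simp: dist_real_def)
  then have "finite S" using finite_pair_set_le finite_subset by blast
  moreover have "S \<subseteq> topspace (mtopology_of pair_space)"
    using S by (rule closedin_subset)
  ultimately show "compactin (mtopology_of pair_space) S"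
    by (simp add: finite_imp_compactin)
qed

lemma left_point_in: "left_point j \<in> pair_set" and right_point_in: "right_point j \<in> pair_set"
  by (auto simp: pair_set_def)

lemma unbounded_pair_space: "unbounded_metric pair_space"
  unfolding unbounded_metric_def
proof
  assume "Metric_space.mbounded (mspace pair_space) (mdist pair_space) (mspace pair_space)"
  then obtain c B where *: "\<And>j. dist c (left_point j) \<le> B"
    using mbounded_pair_space left_point_in by (metis mspace_pair_space)
  obtain j :: nat where "\<bar>c\<bar> + B < real j" using reals_Archimedean2 by blast
  with *[of j] left_point_ge_index[of j] show False by (simp add: dist_real_def)
qed

lemma infinite_pair_index: "infinite {j. pair_index j = n \<and> r < left_point j}"
  unfolding infinite_nat_iff_unbounded_le
proof
  fix m
  obtain k :: nat where k: "max r (real m) < real k" using reals_Archimedean2 by blast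
  \<comment> \<open>Fixing the first component n and enlarging k gives positions of index n beyond
    every bound.\<close>
  have "k \<le> prod_encode (n, k)" by (rule le_prod_encode_2)
  then have "r < left_point (prod_encode (n, k))" "m \<le> prod_encode (n, k)"
    using left_point_ge_index[of "prod_encode (n, k)"] k by auto
  then show "\<exists>j\<ge>m. j \<in> {j. pair_index j = n \<and> r < left_point j}"
    by (auto simp: pair_index_def intro!: exI[of _ "prod_encode (n, k)"])
qed

section \<open>Traces on the corona and a function without extension\<close>

lemma continuous_on_locally_constant:
  fixes f :: "'a::topological_space \<Rightarrow> 'b::topological_space"
  assumes "\<And>x. x \<in> D \<Longrightarrow> \<exists>U. open U \<and> x \<in> U \<and> (\<forall>y\<in>D \<inter> U. f y = f x)"
  shows "continuous_on D f"
  unfolding continuous_on_topological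
proof (intro ballI allI impI)
  fix x B assume "x \<in> D" and B: "open B" "f x \<in> B"
  then obtain U where "open U" "x \<in> U" "\<forall>y\<in>D \<inter> U. f y = f x" using assms by blast
  with B(2) show "\<exists>A. open A \<and> x \<in> A \<and> (\<forall>y\<in>D. y \<in> A \<longrightarrow> f y \<in> B)"
    by (intro exI[of _ U]) auto
qed

definition left_set :: "nat \<Rightarrow> real set" where
  "left_set n = left_point ` {j. pair_index j = n}"

definition right_set :: "nat \<Rightarrow> real set" where
  "right_set n = right_point ` {j. pair_index j = n}"

text \<open>Only pairs of index exactly n are split.\<close>

lemma higson_subpower_left_set: "higson_subpower pair_space 0 (indicator (left_set n))"
proof (rule higson_subpower_indicator)
  show "left_point j \<in> left_set n \<longleftrightarrow> right_point j \<in> left_set n" if "n < pair_index j" for j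
    using that left_point_neq_right_point
    by (auto simp: left_set_def inj_eq[OF inj_left_point] intro: sym)
qed

lemma higson_subpower_right_set: "higson_subpower pair_space 0 (indicator (right_set n))"
proof (rule higson_subpower_indicator)
  show "left_point j \<in> right_set n \<longleftrightarrow> right_point j \<in> right_set n" if "n < pair_index j" for j
    using that left_point_neq_right_point
    by (auto simp: right_set_def inj_eq[OF inj_right_point])
qed

lemma left_set_Int_right_set: "left_set m \<inter> right_set n = {}"
  using left_point_neq_right_point by (auto simp: left_set_def right_set_def)

abbreviation pair_corona :: "((real \<Rightarrow> real) \<Rightarrow> real) set" where
  "pair_corona \<equiv> higson_points pair_space 0 - higson_eval pair_space 0 ` pair_set"

text \<open>For a Higson subpower indicator, its coordinate is the continuous extension of the
  indicator, so this is the part of the closure of A that lies in the corona. The coordinate form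
  gives closedness at once.\<close>

definition trace_on :: "real set \<Rightarrow> ((real \<Rightarrow> real) \<Rightarrow> real) set" where
  "trace_on A = {z \<in> pair_corona. z (indicator A) = 1}"

text \<open>By density the extended indicator takes only the values 0 and 1, so the closed condition
  of being 1 equals the open one of being nonzero: the trace is clopen.\<close>

lemma trace_on_eq_open:
  assumes "higson_subpower pair_space 0 (indicator A)"
  shows "trace_on A = pair_corona \<inter> {z. z (indicator A) \<in> - {0}}"
proof -
  have "z (indicator A) \<in> {0, 1}" if "z \<in> higson_points pair_space 0" for z
    using assms by (rule higson_points_coordinate) (use that in \<open>auto simp: indicator_def\<close>)
  then show ?thesis by (fastforce simp: trace_on_def)
qed

text \<open>The product of the two extended indicators vanishes on the dense image, hence
  everywhere.\<close>

lemma trace_on_disjoint: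
  assumes A: "higson_subpower pair_space 0 (indicator A)"
    and B: "higson_subpower pair_space 0 (indicator B)" and "A \<inter> B = {}"
  shows "trace_on A \<inter> trace_on B = {}"
proof -
  have "closed ((\<lambda>z :: (real \<Rightarrow> real) \<Rightarrow> real. z (indicator A) * z (indicator B)) -` {0})"
    by (intro closed_vimage closed_singleton continuous_on_mult continuous_on_coordinate)
  moreover have "higson_eval pair_space 0 x \<in>
      (\<lambda>z :: (real \<Rightarrow> real) \<Rightarrow> real. z (indicator A) * z (indicator B)) -` {0}" for x
    using A B \<open>A \<inter> B = {}\<close> by (auto simp: higson_eval_def indicator_def)
  ultimately have "higson_points pair_space 0 \<subseteq>
      (\<lambda>z :: (real \<Rightarrow> real) \<Rightarrow> real. z (indicator A) * z (indicator B)) -` {0}"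
    by (rule higson_points_minimal)
  then show ?thesis by (auto simp: trace_on_def)
qed

lemma compact_pair_corona: "compact pair_corona"
  using compact_higson_corona[of pair_space 0] higson_subpower_indicator_singleton by simp

lemma compact_trace_on: "compact (trace_on A)"
proof -
  have "trace_on A = pair_corona \<inter> {z. z (indicator A) \<in> {1}}"
    by (auto simp: trace_on_def)
  then show ?thesis
    by (metis compact_Int_closed compact_pair_corona closed_coordinate closed_singleton)
qed

text \<open>Used contrapositively: if G exceeds c on the trace of A, then G \<le> c holds at only
  finitely many points of A. A cluster point of P in the corona inherits both closed
  conditions.\<close>

lemma corona_limit_le:
  fixes G :: "((real \<Rightarrow> real) \<Rightarrow> real) \<Rightarrow> real"
  assumes G: "continuous_on (higson_points pair_space 0) G"
    and A: "higson_subpower pair_space 0 (indicator A)"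
    and P: "infinite P" "P \<subseteq> A" "P \<subseteq> pair_set"
    and le: "\<And>x. x \<in> P \<Longrightarrow> G (higson_eval pair_space 0 x) \<le> c"
  shows "\<exists>z\<in>trace_on A. G z \<le> c"
proof -
  let ?K = "higson_points pair_space 0" and ?e = "higson_eval pair_space 0"
  obtain z where z: "z \<in> pair_corona" "z \<in> closure (?e ` P)"
    using higson_corona_cluster[of pair_space 0 P] higson_subpower_indicator_singleton P by auto
  define C where "C = (?K \<inter> G -` {..c}) \<inter> {z. z (indicator A) \<in> {1}}"
  have "closed ?K" using compact_higson_points by (rule compact_imp_closed)
  then have "closed C"
    unfolding C_def by (intro closed_Int closed_coordinate continuous_closed_preimage[OF G]) auto
  moreover have "?e ` P \<subseteq> C"
    using P le A by (auto simp: C_def higson_eval_in_points higson_eval_def)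
  ultimately have "z \<in> C" using z(2) closure_minimal by blast
  then show ?thesis using z(1) by (intro bexI[of _ z]) (simp_all add: C_def trace_on_def)
qed

text \<open>On pairs of one suitable index the values of G tend to 1 on the left and to 0 on the
  right. The cut-offs 3/4 and 1/4 differ by the 1/2 that the Higson condition forbids far
  out.\<close>

lemma no_corona_extension:
  fixes G :: "((real \<Rightarrow> real) \<Rightarrow> real) \<Rightarrow> real"
  assumes G: "continuous_on (higson_points pair_space 0) G"
    and G1: "\<And>n z. z \<in> trace_on (left_set n) \<Longrightarrow> G z = 1"
    and G0: "\<And>n z. z \<in> trace_on (right_set n) \<Longrightarrow> G z = 0"
  shows False
proof -
  define h where "h x = G (higson_eval pair_space 0 x)" for x
  have "higson_subpower pair_space 0 h"
    unfolding h_def by (rule continuous_on_higson_points_imp_higson[OF G])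
  then have "\<exists>\<alpha>>0. \<exists>r. \<forall>x\<in>pair_set. \<forall>y\<in>pair_set.
      dist x 0 > r \<longrightarrow> dist x y < dist x 0 powr \<alpha> \<longrightarrow> \<bar>h x - h y\<bar> < 1/2"
    unfolding higson_subpower_iff mspace_pair_space mdist_pair_space
    by (elim conjE allE[of _ "1/2"]) simp
  then obtain \<alpha> r where "\<alpha> > 0" and r: "\<And>x y. x \<in> pair_set \<Longrightarrow> y \<in> pair_set \<Longrightarrow>
      dist x 0 > r \<Longrightarrow> dist x y < dist x 0 powr \<alpha> \<Longrightarrow> \<bar>h x - h y\<bar> < 1/2"
    by meson
  \<comment> \<open>The index is chosen so large that the gap exponent 1/(n+2) falls below \<alpha>;
    infinitely many pairs have this index.\<close>
  obtain n :: nat where n: "1 / \<alpha> < real n" using reals_Archimedean2 by blast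
  define J where "J = {j. pair_index j = n \<and> r < left_point j}"
  have close: "\<bar>h (left_point j) - h (right_point j)\<bar> < 1/2" if "j \<in> J" for j
  proof (rule r)
    have L: "4 \<le> left_point j" by (rule left_point_ge)
    then show "r < dist (left_point j) 0" using that by (simp add: J_def)
    have "1 / (real n + 2) < \<alpha>"
    proof -
      have "1 < real n * \<alpha>" using n \<open>\<alpha> > 0\<close> by (simp add: field_simps)
      also have "\<dots> \<le> (real n + 2) * \<alpha>" using \<open>\<alpha> > 0\<close> by simp
      finally show ?thesis by (simp add: field_simps)
    qed
    then have "left_point j powr (1 / (real n + 2)) < left_point j powr \<alpha>"
      using L by simp
    then show "dist (left_point j) (right_point j) < dist (left_point j) 0 powr \<alpha>"
      using that L pair_dist(1)[of "left_point j" "right_point j" j] by (simp add: J_def)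
  qed (auto simp: pair_set_def)
  have "\<exists>z\<in>trace_on (left_set n). G z \<le> 3/4" if "infinite {j \<in> J. h (left_point j) \<le> 3/4}"
  proof -
    have "infinite (left_point ` {j \<in> J. h (left_point j) \<le> 3/4})"
      using that finite_imageD[OF _ inj_on_subset[OF inj_left_point subset_UNIV]] by blast
    then show ?thesis
      by (rule corona_limit_le[OF G higson_subpower_left_set])
        (auto simp: left_set_def J_def left_point_in h_def)
  qed
  then have fin: "finite {j \<in> J. h (left_point j) \<le> 3/4}" using G1 by fastforce
  \<comment> \<open>The lower bound on the right points becomes an upper bound for -G.\<close>
  have "\<exists>z\<in>trace_on (right_set n). - G z \<le> - (1/4)" if "infinite {j \<in> J. h (right_point j) \<ge> 1/4}"
  proof -
    have "infinite (right_point ` {j \<in> J. h (right_point j) \<ge> 1/4})"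
      using that finite_imageD[OF _ inj_on_subset[OF inj_right_point subset_UNIV]] by blast
    then show ?thesis
      by (rule corona_limit_le[OF continuous_on_minus[OF G] higson_subpower_right_set])
        (auto simp: right_set_def J_def right_point_in h_def)
  qed
  then have "finite {j \<in> J. h (right_point j) \<ge> 1/4}" using G0 by fastforce
  with fin have "finite ({j \<in> J. h (left_point j) \<le> 3/4} \<union> {j \<in> J. h (right_point j) \<ge> 1/4})"
    by blast
  \<comment> \<open>If both cut-offs were respected at j, the two values of h would differ by more
    than 1/2. Hence the infinite set \<open>J\<close> is covered by two finite sets.\<close>
  moreover have "J \<subseteq> {j \<in> J. h (left_point j) \<le> 3/4} \<union> {j \<in> J. h (right_point j) \<ge> 1/4}"
    using close by (fastforce simp: abs_real_def split: if_splits)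
  ultimately show False
    using infinite_pair_index[of n r] finite_subset unfolding J_def by blast
qed

lemma corona_pair_space:
  "corona pair_space (top_of_set (higson_points pair_space 0)) (higson_eval pair_space 0)
    = top_of_set pair_corona"
  by (simp add: corona_def subtopology_subtopology Int_absorb1 Diff_subset)

lemma not_C_star_embedded_traces:
  "\<not> C_star_embedded (top_of_set pair_corona) (\<Union>n. trace_on (left_set n) \<union> trace_on (right_set n))"
  (is "\<not> C_star_embedded _ ?D")
proof
  assume emb: "C_star_embedded (top_of_set pair_corona) ?D"
  define f :: "((real \<Rightarrow> real) \<Rightarrow> real) \<Rightarrow> real"
    where "f = indicator (\<Union>n. trace_on (left_set n))"
  have f1: "f z = 1" if "z \<in> trace_on (left_set n)" for z n
    using that by (auto simp: f_def indicator_def)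
  have f0: "f z = 0" if "z \<in> trace_on (right_set n)" for z n
    using that trace_on_disjoint[OF higson_subpower_left_set higson_subpower_right_set
        left_set_Int_right_set]
    by (fastforce simp: f_def indicator_def)
  have D: "?D \<subseteq> pair_corona" by (auto simp: trace_on_def)
  \<comment> \<open>Each trace is relatively open in the corona, so a function constant on every
    trace is locally constant on \<open>?D\<close>. Infinitely many traces cause no difficulty
    here.\<close>
  have const_near: "\<exists>U. open U \<and> z \<in> U \<and> (\<forall>y\<in>?D \<inter> U. f y = f z)"
    if z: "z \<in> trace_on A" and A: "higson_subpower pair_space 0 (indicator A)"
      and c: "\<And>y. y \<in> trace_on A \<Longrightarrow> f y = c" for z A c
  proof (intro exI conjI ballI)
    let ?U = "{z :: (real \<Rightarrow> real) \<Rightarrow> real. z (indicator A) \<in> - {0}}"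
    show "open ?U" by (rule open_coordinate_nonzero)
    show "z \<in> ?U" using z unfolding trace_on_eq_open[OF A] by (rule IntD2)
    fix y assume "y \<in> ?D \<inter> ?U"
    then have "y \<in> trace_on A" using D unfolding trace_on_eq_open[OF A] by blast
    then show "f y = f z" using c z by simp
  qed
  have "continuous_on ?D f"
  proof (rule continuous_on_locally_constant)
    fix z assume "z \<in> ?D"
    then obtain n where "z \<in> trace_on (left_set n) \<or> z \<in> trace_on (right_set n)" by blast
    then show "\<exists>U. open U \<and> z \<in> U \<and> (\<forall>y\<in>?D \<inter> U. f y = f z)"
    proof
      assume "z \<in> trace_on (left_set n)"
      then show ?thesis by (rule const_near[OF _ higson_subpower_left_set f1])
    next
      assume "z \<in> trace_on (right_set n)"
      then show ?thesis by (rule const_near[OF _ higson_subpower_right_set f0])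
    qed
  qed
  moreover have "bounded (f ` ?D)"
    by (rule boundedI[of _ 1]) (auto simp: f_def indicator_def)
  moreover have sub: "subtopology (top_of_set pair_corona) ?D = top_of_set ?D"
    using D by (simp only: subtopology_subtopology Int_absorb1)
  ultimately have "bounded_continuous (subtopology (top_of_set pair_corona) ?D) f"
    unfolding bounded_continuous_def sub by simp
  with emb have "\<exists>g. continuous_map (top_of_set pair_corona) euclideanreal g \<and> (\<forall>z\<in>?D. g z = f z)"
    unfolding C_star_embedded_def by (elim conjE allE impE)
  then obtain g where g: "continuous_map (top_of_set pair_corona) euclideanreal g"
    "\<And>z. z \<in> ?D \<Longrightarrow> g z = f z"
    by (elim exE conjE) (erule that, erule bspec)
  let ?K = "top_of_set (higson_points pair_space 0)"
  have comp: "hausdorff_compactification (mtopology_of pair_space) ?K (higson_eval pair_space 0)"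
    using higson_subpower_compactification_higson_points[of pair_space 0]
      higson_subpower_indicator_singleton
    by (simp add: higson_subpower_compactification_def)
  \<comment> \<open>The corona is closed in a compact Hausdorff, hence normal, space. Tietze carries
    \<open>g\<close> to all of \<open>?K\<close>, where restriction to the pair space yields a
    Higson function.\<close>
  then have "normal_space ?K"
    unfolding hausdorff_compactification_def
    using compact_Hausdorff_or_regular_imp_normal_space by blast
  moreover have "closedin ?K pair_corona"
    using compact_imp_closed[OF compact_pair_corona] by (intro closed_subset) auto
  moreover have "continuous_map (subtopology ?K pair_corona) euclideanreal g"
    using g(1) by (simp add: subtopology_subtopology Int_absorb1 Diff_subset)
  ultimately obtain G where G: "continuous_map ?K euclideanreal G"
    "\<And>z. z \<in> pair_corona \<Longrightarrow> G z = g z"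
    using Tietze_extension_realinterval[of ?K pair_corona UNIV g] by auto
  show False
  proof (rule no_corona_extension)
    show "continuous_on (higson_points pair_space 0) G" using G(1) by simp
    show "G z = 1" if "z \<in> trace_on (left_set n)" for n z
    proof -
      have "z \<in> ?D" using that by blast
      then show ?thesis using G(2)[of z] g(2)[of z] f1[OF that] D by auto
    qed
    show "G z = 0" if "z \<in> trace_on (right_set n)" for n z
    proof -
      have "z \<in> ?D" using that by blast
      then show ?thesis using G(2)[of z] g(2)[of z] f0[OF that] D by auto
    qed
  qed
qed

lemma sigma_compactin_traces:
  "sigma_compactin (top_of_set pair_corona)
    (\<Union>n. trace_on (left_set n) \<union> trace_on (right_set n))"
proof -
  have "compactin (top_of_set pair_corona) (trace_on (left_set n) \<union> trace_on (right_set n))" for n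
    using compact_Un[OF compact_trace_on compact_trace_on]
    by (auto simp: compactin_subtopology trace_on_def)
  then show ?thesis
    unfolding sigma_compactin_def
    by (intro exI[of _ "\<lambda>n. trace_on (left_set n) \<union> trace_on (right_set n)"]) simp
qed

theorem theorem3p3:
  shows "\<exists>(X :: real metric) (x0 :: real).
           proper_metric X \<and> unbounded_metric X \<and> x0 \<in> mspace X \<and>
           (\<exists>(hX :: ((real \<Rightarrow> real) \<Rightarrow> real) topology) (e :: real \<Rightarrow> (real \<Rightarrow> real) \<Rightarrow> real).
              higson_subpower_compactification X x0 hX e \<and>
              (\<exists>D. D \<subseteq> topspace (corona X hX e) \<and>
                   sigma_compactin (corona X hX e) D \<and>
                   \<not> C_star_embedded (corona X hX e) D))"
proof -
  let ?D = "\<Union>n. trace_on (left_set n) \<union> trace_on (right_set n)"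
  let ?K = "top_of_set (higson_points pair_space 0)" and ?e = "higson_eval pair_space 0"
  have "?D \<subseteq> topspace (corona pair_space ?K ?e)"
    unfolding corona_pair_space by (auto simp: trace_on_def)
  moreover have "sigma_compactin (corona pair_space ?K ?e) ?D"
    unfolding corona_pair_space by (rule sigma_compactin_traces)
  moreover have "\<not> C_star_embedded (corona pair_space ?K ?e) ?D"
    unfolding corona_pair_space by (rule not_C_star_embedded_traces)
  moreover have "higson_subpower_compactification pair_space 0 ?K ?e"
    using higson_subpower_indicator_singleton
    by (intro higson_subpower_compactification_higson_points) simp
  moreover have "0 \<in> mspace pair_space" by (simp add: pair_set_def)
  ultimately show ?thesis
    using proper_pair_space unbounded_pair_space by blast
qed

end
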